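(* Let $(\alpha_1,\alpha_2)\in\mathbb{R}^2$ be totally irrational, and let $\underline{a}=(a_1,\dots,a_d)\in\mathbb{R}^d$, $d\ge1$. If $\alpha_1$, $\alpha_2$ or $\alpha_1-\alpha_2$ is badly approximable, then the compact extension $\tilde T_{\alpha,\Phi_{\underline a}}$ is ergodic on $\mathbb{T}^2\times\mathbb{T}^d$ if $\underline{a}$ is totally irrational.
   Context: A vector $(v_1,\dots,v_m)\in\mathbb{R}^m$ is totally irrational if $1,v_1,\dots,v_m$ are linearly independent over $\mathbb{Q}$. A real number $\theta$ is badly approximable ($\theta\in\mathrm{Bad}$) if there is $c>0$ with $\|q\theta\|\ge c/|q|$ for all $q\in\mathbb{Z}\setminus\{0\}$, where $\|u\|$ is the distance from $u$ to $\mathbb{Z}$. $\Delta_0=\{(x_1,x_2)\in[0,1]^2: x_1<x_2\}$, viewed in $\mathbb{T}^2$, and $\Phi_{\underline a}=1_{\Delta_0}\,\underline{a}$. For $\alpha=(\alpha_1,\alpha_2)$, $$\tilde T_{\alpha,\Phi_{\underline a}}:\ (x,y)\in\mathbb{T}^2\times\mathbb{T}^d\ \mapsto\ (x+\alpha \bmod 1,\ y+\Phi_{\underline a}(x)\bmod 1).$$ Ergodicity is with respect to the Haar (Lebesgue) measure of $\mathbb{T}^2\times\mathbb{T}^d$. *)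

theory Defs
  imports "HOL-Analysis.Analysis"
begin

definition totally_irrational :: "real ^ 'm \<Rightarrow> bool" where
  "totally_irrational v \<longleftrightarrow>
     (\<forall>(q0::rat) (q::'m \<Rightarrow> rat).
        of_rat q0 * 1 + (\<Sum>i\<in>UNIV. of_rat (q i) * v $ i) = 0 \<longrightarrow> q0 = 0 \<and> (\<forall>i. q i = 0))"

definition badly_approximable :: "real \<Rightarrow> bool" where
  "badly_approximable \<theta> \<longleftrightarrow>
     (\<exists>c>0. \<forall>q::int. q \<noteq> 0 \<longrightarrow> infdist (of_int q * \<theta>) \<int> \<ge> c / of_int \<bar>q\<bar>)"

text \<open>
  The torus \<open>\<real>\<^sup>n/\<int>\<^sup>n\<close> is represented by the fundamental domain \<open>[0,1)\<^sup>n\<close>, and \<open>mod1\<close> is the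
  quotient projection. Under this identification normalised Haar measure is Lebesgue measure on
  the Borel subsets of the domain.
\<close>

definition mod1 :: "real ^ 'n \<Rightarrow> real ^ 'n" where
  "mod1 x = (\<chi> i. frac (x $ i))"

definition torus :: "(real ^ 'n) measure" where
  "torus = restrict_space lborel {x. \<forall>i. 0 \<le> x $ i \<and> x $ i < 1}"

definition ergodic :: "'a measure \<Rightarrow> ('a \<Rightarrow> 'a) \<Rightarrow> bool" where
  "ergodic M T \<longleftrightarrow>
     T \<in> measurable M M \<and> distr M M T = M \<and>
     (\<forall>A\<in>sets M. T -` A \<inter> space M = A \<longrightarrow> A \<in> null_sets M \<or> space M - A \<in> null_sets M)"

definition Delta0 :: "(real ^ 2) set" where
  "Delta0 = {x. (\<forall>i. x $ i \<in> {0..1}) \<and> x $ 1 < x $ 2}"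

text \<open>
  \<open>Delta0\<close> lies in the closed square, so it is viewed in the torus through its image under
  \<open>mod1\<close>. This image contains the null set \<open>x\<^sub>2 = 0\<close>, coming from the edge \<open>x\<^sub>2 = 1\<close>.
\<close>

definition Phi :: "real ^ 'd \<Rightarrow> real ^ 2 \<Rightarrow> real ^ 'd" where
  "Phi a x = indicat_real (mod1 ` Delta0) x *\<^sub>R a"

definition compact_extension ::
  "real ^ 2 \<Rightarrow> (real ^ 2 \<Rightarrow> real ^ 'd) \<Rightarrow> (real ^ 2) \<times> (real ^ 'd) \<Rightarrow> (real ^ 2) \<times> (real ^ 'd)" where
  "compact_extension \<alpha> \<phi> = (\<lambda>(x, y). (mod1 (x + \<alpha>), mod1 (y + \<phi> x)))"

end

theory Submission
  imports Defs "HOL-Probability.Probability_Measure"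
begin

text \<open>
  Let \<open>S\<^sub>n\<close> be the Birkhoff sums of \<open>\<phi> = Phi a\<close> along the rotation by \<open>\<alpha>\<close>, so that the \<open>n\<close>-th iterate
  of the extension is \<open>(x, y) \<mapsto> (x + n\<alpha>, y + S\<^sub>n x)\<close>. The proof compares the orbits of two points
  \<open>x\<close> and \<open>x + h\<close> whose distance is about \<open>1 / n\<close>, and finds many \<open>x\<close> for which \<open>S\<^sub>n\<close> jumps by exactly
  one copy of \<open>a\<close> between them.

  Suppose that there are \<open>\<delta> > 0\<close>, vectors \<open>h\<close> tending to \<open>0\<close>, and sets \<open>E\<close> of measure at least \<open>\<delta>\<close> with
  \<open>S\<^sub>n (x + h) = S\<^sub>n x + b\<close> for all \<open>x \<in> E\<close> (with \<open>n\<close> and \<open>E\<close> depending on \<open>h\<close>), and let \<open>A\<close> be an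
  invariant set. A small translation barely changes \<open>A\<close>. Applying this both to \<open>(x, y)\<close> and to its image
  under an iterate shows that, up to an error that vanishes with \<open>h\<close>, membership of \<open>(x, y)\<close> in \<open>A\<close> agrees
  with that of \<open>(x, y + b)\<close> over \<open>E\<close>. How far a fibre of \<open>A\<close> is from being invariant under the rotation
  by \<open>b\<close> is an invariant function of the base point, so it is constant by ergodicity of the base rotation,
  and being small in mean over sets of measure at least \<open>\<delta>\<close> it vanishes
  (\<open>invariant_under_essential_value\<close>). If \<open>b\<close> is totally irrational, almost every fibre of \<open>A\<close> is therefore
  null or conull, and by ergodicity of the base rotation once more so is \<open>A\<close>
  (\<open>ergodic_if_totally_irrational_essential_value\<close>). Rotations by totally irrational vectors are ergodic
  because the multiples of such a vector are dense by Kronecker's theorem, while the measure by which a set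
  moves depends continuously on the rotation (\<open>rotation_ergodic\<close>).

  It remains to find \<open>E\<close> with \<open>b = \<plusminus> a\<close>. The boundary of the triangle consists of the three circles
  \<open>x\<^sub>1 = 0\<close>, \<open>x\<^sub>2 = 0\<close> and \<open>x\<^sub>1 = x\<^sub>2\<close>, and on the torus its indicator is
  \<open>1 + frac (x\<^sub>1 - x\<^sub>2) - frac x\<^sub>1 - frac (- x\<^sub>2)\<close> (\<open>Phi_eq_frac\<close>). Choose \<open>h\<close> of length \<open>s = 1 / (K n)\<close>
  parallel to one of the first two circles. It increases two of the three arguments, \<open>p\<close> and \<open>q\<close>, by \<open>s\<close>
  and fixes the third, so the linear growth cancels and \<open>S\<^sub>n\<close> changes by \<open>a\<close> times the number of times
  that \<open>p\<close> passes an integer minus the same number for \<open>q\<close> (\<open>birkhoff_sum_jump\<close>). If the rotation number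
  of \<open>p\<close> is badly approximable, then the points of its orbit are so well separated that for large \<open>K\<close> the
  first number is at most 1 (\<open>badly_approximable_wraps_once\<close>). Each number has mean \<open>1 / K\<close>, and since
  \<open>p\<close> and \<open>q\<close> are independent, the first is 1 and the second is 0 with probability at least
  \<open>1 / K - 1 / K\<^sup>2\<close>, which does not depend on \<open>n\<close> (\<open>prob_single_crossing\<close>). The same holds with \<open>p\<close> and
  \<open>q\<close> exchanged.
\<close>

section \<open>Rotations of the torus\<close>

lemma space_torus: "space (torus :: (real^'n) measure) = {x. \<forall>i. 0 \<le> x $ i \<and> x $ i < 1}"
  by (simp add: torus_def space_restrict_space)

lemma mod1_in_torus [simp]: "mod1 x \<in> space torus"
  by (simp add: space_torus mod1_def frac_lt_1)

lemma mod1_torus: "x \<in> space torus \<Longrightarrow> mod1 x = x"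
  by (simp add: space_torus mod1_def vec_eq_iff frac_eq)

lemma mod1_add_mod1 [simp]: "mod1 (mod1 x + y) = mod1 (x + y)" "mod1 (x + mod1 y) = mod1 (x + y)"
  by (simp_all add: mod1_def vec_eq_iff)

lemma fundamental_domain_borel [measurable]:
  "{x :: real^'n. \<forall>i. 0 \<le> x $ i \<and> x $ i < 1} \<in> sets borel"
proof -
  have "{x :: real^'n. \<forall>i. 0 \<le> x $ i \<and> x $ i < 1} = (\<Inter>i. {x. 0 \<le> x $ i \<and> x $ i < 1})"
    by auto
  also have "\<dots> \<in> sets borel"
    by (intro sets.finite_INT) measurable
  finally show ?thesis .
qed

lemma measurable_mod1 [measurable]: "mod1 \<in> measurable borel (torus :: (real^'n) measure)"
proof -
  have "(\<lambda>x. mod1 x \<bullet> b) \<in> borel_measurable borel" if b: "b \<in> Basis" for b :: "real^'n"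
  proof -
    obtain i where i: "b = axis i 1" using b by (auto simp: Basis_vec_def)
    have "(\<lambda>x::real^'n. frac (x $ i)) \<in> borel_measurable borel"
      unfolding frac_def by measurable
    then show ?thesis by (simp add: i inner_axis mod1_def)
  qed
  then have "mod1 \<in> measurable borel (borel :: (real^'n) measure)"
    by (subst borel_measurable_euclidean_space) auto
  then show ?thesis
    unfolding torus_def by (intro measurable_restrict_space2) (auto simp: mod1_def frac_lt_1)
qed

lemma sets_torus: "A \<in> sets (torus :: (real^'n) measure) \<longleftrightarrow> A \<in> sets borel \<and> A \<subseteq> space torus"
  unfolding space_torus by (auto simp: torus_def sets_restrict_space_iff)

lemma emeasure_torus: "A \<in> sets torus \<Longrightarrow> emeasure torus A = emeasure lborel A"
  unfolding sets_torus space_torus unfolding torus_def by (subst emeasure_restrict_space) auto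

lemma borel_imp_torus: "f \<in> measurable borel N \<Longrightarrow> f \<in> measurable torus N"
  unfolding torus_def by (intro measurable_restrict_space1) (simp cong: measurable_cong_sets)

lemma prob_space_torus: "prob_space (torus :: (real^'n) measure)"
proof (rule prob_spaceI)
  have "emeasure lborel (box (0::real^'n) 1) \<le> emeasure lborel (space (torus :: (real^'n) measure))"
    by (intro emeasure_mono) (auto simp: space_torus mem_box_cart less_imp_le)
  moreover have "emeasure lborel (space (torus :: (real^'n) measure)) \<le> emeasure lborel (cbox (0::real^'n) 1)"
    by (intro emeasure_mono) (auto simp: space_torus mem_box_cart less_imp_le)
  moreover have "(1::real^'n) \<bullet> b = 1" "(0::real^'n) \<bullet> b \<le> 1 \<bullet> b" if "b \<in> Basis" for b
    using that by (auto simp: Basis_vec_def inner_axis)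
  then have "emeasure lborel (box (0::real^'n) 1) = 1" "emeasure lborel (cbox (0::real^'n) 1) = 1"
    by (simp_all add: emeasure_lborel_box emeasure_lborel_cbox)
  ultimately show "emeasure torus (space (torus :: (real^'n) measure)) = 1"
    by (simp add: emeasure_torus)
qed

lemma rotation_measurable [measurable]: "(\<lambda>x. mod1 (x + v)) \<in> measurable torus torus"
  by (rule borel_imp_torus) measurable

text \<open>
  On each piece of the domain where \<open>x + v\<close> has a given vector of integer parts, the rotation is a
  translation of \<open>\<real>\<^sup>n\<close>, and the images of the countably many pieces partition the domain again.
\<close>
lemma distr_rotation:
  fixes v :: "real^'n"
  shows "distr torus torus (\<lambda>x. mod1 (x + v)) = torus"
proof (rule measure_eqI)
  fix A :: "(real^'n) set"
  assume "A \<in> sets (distr torus torus (\<lambda>x. mod1 (x + v)))"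
  then have A: "A \<in> sets torus" and [measurable]: "A \<in> sets borel" and AC: "A \<subseteq> space torus"
    by (simp_all add: sets_torus)
  \<comment> \<open>\<open>P k\<close> is the part of the preimage on which the integer part of \<open>x + v\<close> is \<open>k\<close>, and
    \<open>Q k\<close> is its image, a piece of \<open>A\<close>.\<close>
  define c :: "int^'n \<Rightarrow> real^'n" where "c k = v - (\<chi> i. of_int (k $ i))" for k
  define P where "P k = {x \<in> space torus. x + c k \<in> A}" for k
  define Q where "Q k = {z \<in> A. z - c k \<in> space torus}" for k
  have [measurable]: "space (torus :: (real^'n) measure) \<in> sets borel"
    unfolding space_torus by measurable
  have mP [measurable]: "P k \<in> sets borel" and mQ [measurable]: "Q k \<in> sets borel" for k
    unfolding P_def Q_def by measurable
  have c_unique: "k = l" if "x \<in> space torus" "y \<in> space torus" "x - y = c k - c l" for k l x y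
  proof -
    have "k $ i = l $ i" for i
    proof -
      have "x $ i - y $ i = of_int (l $ i) - of_int (k $ i)"
        using arg_cong[OF that(3), of "\<lambda>x. x $ i"] by (simp add: c_def)
      moreover have "\<bar>x $ i - y $ i\<bar> < 1"
        using that(1,2) by (auto simp: space_torus abs_if) (smt (verit))+
      ultimately show ?thesis by linarith
    qed
    then show ?thesis by (simp add: vec_eq_iff)
  qed
  have mod1_plus_v: "\<exists>k. mod1 (x + v) = x + c k" for x
    by (intro exI[of _ "\<chi> i. \<lfloor>(x + v) $ i\<rfloor>"]) (auto simp: c_def mod1_def frac_def vec_eq_iff)
  have mod1_add_c: "mod1 (x + c k) = mod1 (x + v)" for x k
    by (simp add: c_def mod1_def vec_eq_iff frac_def algebra_simps)
  have mod1_minus_v: "\<exists>k. mod1 (x - v) = x - c k" for x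
    by (intro exI[of _ "\<chi> i. - \<lfloor>(x - v) $ i\<rfloor>"]) (auto simp: c_def mod1_def frac_def vec_eq_iff)
  have disjP: "disjoint_family P" and disjQ: "disjoint_family Q"
  proof -
    have "k = l" if "z \<in> P k" "z \<in> P l" for z k l
      using that AC by (intro c_unique[of "z + c k" "z + c l"]) (auto simp: P_def)
    then show "disjoint_family P" by (auto simp: disjoint_family_on_def)
    have "k = l" if "z \<in> Q k" "z \<in> Q l" for z k l
      using that by (intro c_unique[of "z - c l" "z - c k"]) (auto simp: Q_def)
    then show "disjoint_family Q" by (auto simp: disjoint_family_on_def)
  qed
  have "emeasure (distr torus torus (\<lambda>x. mod1 (x + v))) A
      = emeasure torus ((\<lambda>x. mod1 (x + v)) -` A \<inter> space torus)"
    using A by (simp add: emeasure_distr)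
  also have "(\<lambda>x. mod1 (x + v)) -` A \<inter> space torus = (\<Union>k. P k)"
  proof -
    have "mod1 (x + v) \<in> A \<longleftrightarrow> (\<exists>k. x + c k \<in> A)" for x
    proof
      assume "mod1 (x + v) \<in> A"
      then show "\<exists>k. x + c k \<in> A" using mod1_plus_v[of x] by auto
    next
      assume "\<exists>k. x + c k \<in> A"
      then obtain k where k: "x + c k \<in> A" by blast
      then have "x + c k = mod1 (x + v)"
        using AC mod1_torus[of "x + c k"] mod1_add_c[of x k] by auto
      with k show "mod1 (x + v) \<in> A" by simp
    qed
    then show ?thesis by (auto simp: P_def)
  qed
  also have "emeasure torus (\<Union>k. P k) = emeasure lborel (\<Union>k. P k)"
    by (intro emeasure_torus) (auto simp: sets_torus P_def)
  also have "\<dots> = (\<integral>\<^sup>+k. emeasure lborel (P k) \<partial>count_space UNIV)"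
    by (intro emeasure_UN_countable disjP) auto
  also have "\<dots> = (\<integral>\<^sup>+k. emeasure lborel (Q k) \<partial>count_space UNIV)"
  proof -
    have "emeasure lborel (Q k) = emeasure lborel (P k)" for k
    proof -
      have "emeasure lborel (Q k) = emeasure (distr lborel borel ((+) (c k))) (Q k)"
        by (simp add: lborel_distr_plus)
      also have "\<dots> = emeasure lborel ((+) (c k) -` Q k)"
        by (subst emeasure_distr) auto
      also have "(+) (c k) -` Q k = P k"
        by (auto simp: P_def Q_def add.commute)
      finally show ?thesis .
    qed
    then show ?thesis by simp
  qed
  also have "\<dots> = emeasure lborel (\<Union>k. Q k)"
    by (intro emeasure_UN_countable[symmetric] disjQ) auto
  also have "(\<Union>k. Q k) = A"
  proof -
    have "\<exists>k. z - c k \<in> space torus" for z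
      using mod1_minus_v[of z] mod1_in_torus[of "z - v"] by metis
    then show ?thesis by (auto simp: Q_def)
  qed
  also have "emeasure lborel A = emeasure torus A"
    using A by (simp add: emeasure_torus)
  finally show "emeasure (distr torus torus (\<lambda>x. mod1 (x + v))) A = emeasure torus A" .
qed simp

section \<open>Small translations and dense orbits\<close>

text \<open>
  Regularity: squeeze \<open>S\<close> between a compact and an open set of nearly the same measure. A translation
  shorter than the distance between them can only move points of \<open>S\<close> across its boundary within the
  gaps of small measure.
\<close>
lemma symmetric_difference_translate_small:
  fixes S :: "'a::euclidean_space set"
  assumes S: "S \<in> sets borel" "bounded S" and e: "e > 0"
  shows "\<exists>d>0. \<forall>h. norm h < d \<longrightarrow> emeasure lborel {x. (x + h \<in> S) \<noteq> (x \<in> S)} < ennreal e"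
proof -
  have SL: "S \<in> sets lebesgue" using S by simp
  have e4: "e / 4 > 0" using e by simp
  obtain U
    where U: "open U" "S \<subseteq> U" "emeasure lebesgue (U - S) < ennreal (e / 4)"
    by (rule sets_lebesgue_outer_open[OF SL e4]) (rule that)
  obtain K
    where K: "closed K" "K \<subseteq> S" "emeasure lebesgue (S - K) < ennreal (e / 4)"
    by (rule sets_lebesgue_inner_closed[OF SL e4]) (rule that)
  have [measurable]: "S \<in> sets borel" "U \<in> sets borel" "K \<in> sets borel"
    using S U K by auto
  have US: "emeasure lborel (U - S) < ennreal (e / 4)" and SK: "emeasure lborel (S - K) < ennreal (e / 4)"
    using U(3) K(3) by simp_all
  have "compact K"
    using K S(2) bounded_subset compact_eq_bounded_closed by blast
  then obtain d where d: "d > 0" "(\<Union>x\<in>K. cball x d) \<subseteq> U"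
    using compact_subset_open_imp_cball_epsilon_subset[of K U] U K by (metis order_trans)
  have trans: "emeasure lborel {x. x + h \<in> X} = emeasure lborel X" if [measurable]: "X \<in> sets borel" for h :: 'a and X
  proof -
    have "emeasure lborel X = emeasure (distr lborel borel ((+) h)) X"
      by (simp add: lborel_distr_plus)
    also have "\<dots> = emeasure lborel {x. x + h \<in> X}"
      by (subst emeasure_distr) (auto simp: vimage_def add.commute)
    finally show ?thesis by simp
  qed
  have "emeasure lborel {x. (x + h \<in> S) \<noteq> (x \<in> S)} < ennreal e" if h: "norm h < d" for h
  proof -
    have "{x. (x + h \<in> S) \<noteq> (x \<in> S)} \<subseteq>
        ((U - S) \<union> {x. x + h \<in> U - S}) \<union> ((S - K) \<union> {x. x + h \<in> S - K})"
    proof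
      fix x assume x: "x \<in> {x. (x + h \<in> S) \<noteq> (x \<in> S)}"
      have "x \<in> U" if "x + h \<in> K"
        using d(2) h that by (force simp: dist_norm)
      moreover have "x + h \<in> U" if "x \<in> K"
        using d(2) h that by (force simp: dist_norm)
      ultimately show "x \<in> ((U - S) \<union> {x. x + h \<in> U - S}) \<union> ((S - K) \<union> {x. x + h \<in> S - K})"
        using x U(2) by blast
    qed
    then have "emeasure lborel {x. (x + h \<in> S) \<noteq> (x \<in> S)} \<le>
        emeasure lborel (((U - S) \<union> {x. x + h \<in> U - S}) \<union> ((S - K) \<union> {x. x + h \<in> S - K}))"
      by (intro emeasure_mono) measurable
    also have "\<dots> \<le> (emeasure lborel (U - S) + emeasure lborel {x. x + h \<in> U - S})
        + (emeasure lborel (S - K) + emeasure lborel {x. x + h \<in> S - K})"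
      by (intro order_trans[OF emeasure_subadditive] add_mono order_refl) measurable
    also have "\<dots> = (emeasure lborel (U - S) + emeasure lborel (U - S)) + (emeasure lborel (S - K) + emeasure lborel (S - K))"
      by (simp add: trans[of "U - S"] trans[of "S - K"] del: Diff_iff)
    also have "\<dots> < (ennreal (e / 4) + ennreal (e / 4)) + (ennreal (e / 4) + ennreal (e / 4))"
      by (intro add_strict_mono US SK)
    also have "\<dots> = ennreal e"
      using e by (simp flip: ennreal_plus)
    finally show ?thesis .
  qed
  then show ?thesis using d(1) by blast
qed

text \<open>
  Periodic continuation of \<open>A\<close> to a neighbourhood of the fundamental domain turns a small rotation into a
  translation.
\<close>
lemma rotation_defect_small:
  fixes A :: "(real^'n) set"
  assumes A: "A \<in> sets torus" and e: "e > 0"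
  shows "\<exists>d>0. \<forall>h. norm h < d \<longrightarrow>
    emeasure torus {x \<in> space torus. (mod1 (x + h) \<in> A) \<noteq> (x \<in> A)} < ennreal e"
proof -
  define S where "S = {x. mod1 x \<in> A} \<inter> cbox (-1) 2"
  have [measurable]: "A \<in> sets borel" using A by (simp add: sets_torus)
  have [measurable]: "mod1 \<in> borel_measurable (borel :: (real^'n) measure)"
    using measurable_mod1 by (auto simp: torus_def measurable_restrict_space2_iff)
  have "S \<in> sets borel" "bounded S"
    unfolding S_def by (auto intro: bounded_Int)
  from symmetric_difference_translate_small[OF this e] obtain d where d: "d > 0"
    "\<And>h. norm h < d \<Longrightarrow> emeasure lborel {x. (x + h \<in> S) \<noteq> (x \<in> S)} < ennreal e" by blast
  have "emeasure torus {x \<in> space torus. (mod1 (x + h) \<in> A) \<noteq> (x \<in> A)} < ennreal e"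
    if h: "norm h < min d 1" for h
  proof -
    have [measurable]: "S \<in> sets borel" by fact
    have "{x \<in> space torus. (mod1 (x + h) \<in> A) \<noteq> (x \<in> A)} \<subseteq> {x. (x + h \<in> S) \<noteq> (x \<in> S)}"
    proof
      fix x assume "x \<in> {x \<in> space torus. (mod1 (x + h) \<in> A) \<noteq> (x \<in> A)}"
      then have x: "x \<in> space torus" and ne: "(mod1 (x + h) \<in> A) \<noteq> (x \<in> A)"
        by auto
      have x_bounds: "0 \<le> x $ i" "x $ i < 1" for i
        using x by (auto simp: space_torus)
      have h_bound: "\<bar>h $ i\<bar> < 1" for i
        using h component_le_norm_cart[of h i] by simp
      have "-1 \<le> (x + h) $ i \<and> (x + h) $ i \<le> 2" for i
        using x_bounds[of i] h_bound[of i] by (simp add: abs_less_iff)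
      then have "x + h \<in> cbox (-1) 2" by (simp add: mem_box_cart)
      moreover have "-1 \<le> x $ i \<and> x $ i \<le> 2" for i
        using x_bounds[of i] by simp
      then have "x \<in> cbox (-1) 2" by (simp add: mem_box_cart)
      ultimately show "x \<in> {x. (x + h \<in> S) \<noteq> (x \<in> S)}"
        using x ne by (simp add: S_def mod1_torus)
    qed
    moreover have "{x \<in> space torus. (mod1 (x + h) \<in> A) \<noteq> (x \<in> A)} \<in> sets torus"
      using A by measurable
    ultimately have "emeasure torus {x \<in> space torus. (mod1 (x + h) \<in> A) \<noteq> (x \<in> A)}
       \<le> emeasure lborel {x. (x + h \<in> S) \<noteq> (x \<in> S)}"
      by (subst emeasure_torus) (auto intro!: emeasure_mono)
    also have "\<dots> < ennreal e" using d(2) h by simp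
    finally show ?thesis .
  qed
  then show ?thesis using d(1) by (intro exI[of _ "min d 1"]) simp
qed

lemma totally_irrational_int_relation:
  assumes "totally_irrational v" "of_int k0 + (\<Sum>i\<in>UNIV. of_int (k i) * v $ i) = 0"
  shows "k0 = 0 \<and> (\<forall>i. k i = 0)"
proof -
  have "of_rat (of_int k0) * 1 + (\<Sum>i\<in>UNIV. of_rat (of_int (k i)) * v $ i) = 0"
    using assms(2) by simp
  then have "(of_int k0 :: rat) = 0 \<and> (\<forall>i. (of_int (k i) :: rat) = 0)"
    by (rule assms(1)[unfolded totally_irrational_def, rule_format])
  then show ?thesis by simp
qed

lemma totally_irrational_uminus:
  assumes "totally_irrational v"
  shows "totally_irrational (- v)"
  unfolding totally_irrational_def
proof (intro allI impI)
  fix q0 :: rat and q :: "'a \<Rightarrow> rat"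
  assume "of_rat q0 * 1 + (\<Sum>i\<in>UNIV. of_rat (q i) * (- v) $ i) = 0"
  then have "of_rat q0 * 1 + (\<Sum>i\<in>UNIV. of_rat (- q i) * v $ i) = 0"
    by (simp add: of_rat_minus)
  from assms[unfolded totally_irrational_def, rule_format, OF this]
  show "q0 = 0 \<and> (\<forall>i. q i = 0)" by simp
qed

text \<open>
  Kronecker's theorem, with the coordinates numbered by an initial segment of \<open>\<nat>\<close> and the number 1 added
  as the last frequency; total irrationality is independence of this enlarged family.
\<close>
lemma multiples_dense_mod_integers:
  fixes v w :: "real^'n"
  assumes v: "totally_irrational v" and e: "e > 0"
  shows "\<exists>(k::int) (m :: 'n \<Rightarrow> int). \<forall>i. \<bar>of_int k * v $ i - of_int (m i) - w $ i\<bar> < e"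
proof -
  define n where "n = CARD('n)"
  obtain f where f: "bij_betw f {..<n} (UNIV :: 'n set)"
    using ex_bij_betw_nat_finite[of "UNIV :: 'n set"] by (auto simp: n_def atLeast0LessThan)
  define \<theta> where "\<theta> i = (if i < n then v $ f i else 1)" for i
  interpret Modules.module "\<lambda>r. (*) (real_of_int r)"
    by (simp add: Modules.module.intro distrib_left mult.commute)
  have v_ne_1: "v $ j \<noteq> 1" for j
  proof
    assume "v $ j = 1"
    then have "of_int (-1) + (\<Sum>i\<in>UNIV. of_int (if i = j then 1 else 0) * v $ i) = (0::real)"
      by (simp add: if_distrib[of of_int] if_distrib[of "\<lambda>x. x * _"] cong: if_cong)
    from totally_irrational_int_relation[OF v this] show False by simp
  qed
  have v_inj: "j = l" if "v $ j = v $ l" for j l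
  proof (rule ccontr)
    assume "j \<noteq> l"
    have "of_int 0 + (\<Sum>i\<in>UNIV. of_int ((if i = j then 1 else 0) - (if i = l then 1 else 0)) * v $ i) = (0::real)"
      using that by (simp add: algebra_simps sum_subtractf if_distrib[of of_int] if_distrib[of "\<lambda>x. x * _"] if_distrib[of "\<lambda>x. _ * x"] cong: if_cong)
    from totally_irrational_int_relation[OF v this] \<open>j \<noteq> l\<close> show False
      by (metis diff_0_right zero_neq_one)
  qed
  have inj: "inj_on \<theta> {..n}"
  proof (rule inj_onI)
    fix i j assume "i \<in> {..n}" "j \<in> {..n}" "\<theta> i = \<theta> j"
    then show "i = j"
      using v_ne_1 v_inj bij_betw_imp_inj_on[OF f]
      by (auto simp: \<theta>_def inj_on_def split: if_splits; metis)
  qed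
  have indep: "independent (\<theta> ` {..n})"
  proof
    assume "dependent (\<theta> ` {..n})"
    then obtain u where u: "\<exists>x\<in>\<theta> ` {..n}. u x \<noteq> 0" "(\<Sum>x\<in>\<theta> ` {..n}. of_int (u x) * x) = 0"
      by (subst (asm) dependent_finite) auto
    have "(\<Sum>x\<in>\<theta> ` {..n}. of_int (u x) * x) = (\<Sum>i\<le>n. of_int (u (\<theta> i)) * \<theta> i)"
      by (subst sum.reindex[OF inj]) simp
    also have "\<dots> = (\<Sum>i<n. of_int (u (\<theta> i)) * \<theta> i) + of_int (u 1)"
      by (simp add: \<theta>_def flip: lessThan_Suc_atMost)
    also have "(\<Sum>i<n. of_int (u (\<theta> i)) * \<theta> i) = (\<Sum>i<n. of_int (u (v $ f i)) * v $ f i)"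
      by (intro sum.cong) (auto simp: \<theta>_def)
    also have "\<dots> = (\<Sum>j\<in>UNIV. of_int (u (v $ j)) * v $ j)"
      by (rule sum.reindex_bij_betw[OF f])
    finally have "of_int (u 1) + (\<Sum>j\<in>UNIV. of_int (u (v $ j)) * v $ j) = 0"
      using u(2) by simp
    from totally_irrational_int_relation[OF v this] u(1) show False
      by (auto simp: \<theta>_def split: if_splits)
  qed
  obtain k m where km: "\<And>i. i < n \<Longrightarrow> \<bar>of_int k * \<theta> i - of_int (m i) - w $ f i\<bar> < e"
    using Kronecker_thm_2[of \<theta> n e "\<lambda>i. w $ f i"] indep inj e by (auto simp: \<theta>_def)
  have "\<bar>of_int k * v $ j - of_int (m (inv_into {..<n} f j)) - w $ j\<bar> < e" for j
  proof -
    have "f (inv_into {..<n} f j) = j" "inv_into {..<n} f j < n"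
      using f bij_betw_inv_into_right[OF f, of j] bij_betwE[OF bij_betw_inv_into[OF f]] by auto
    with km[of "inv_into {..<n} f j"] show ?thesis by (simp add: \<theta>_def)
  qed
  then show ?thesis
    by (intro exI[of _ k] exI[of _ "\<lambda>j. m (inv_into {..<n} f j)"] allI)
qed

section \<open>Ergodicity of totally irrational rotations\<close>

lemma measurable_torus_borel: "f \<in> measurable N (torus :: (real^'n) measure) \<Longrightarrow> f \<in> borel_measurable N"
  unfolding torus_def by (simp add: measurable_restrict_space2_iff)

lemma measurable_torus_add [measurable]:
  assumes "f \<in> measurable N (torus :: (real^'n) measure)" "g \<in> borel_measurable N"
  shows "(\<lambda>x. mod1 (f x + g x)) \<in> measurable N torus"
  using measurable_torus_borel[OF assms(1)] assms(2) by measurable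

lemma emeasure_rotation_vimage:
  fixes v :: "real^'n"
  assumes [measurable]: "B \<in> sets torus"
  shows "emeasure torus {x \<in> space torus. mod1 (x + v) \<in> B} = emeasure torus B"
proof -
  have "emeasure torus B = emeasure (distr torus torus (\<lambda>x. mod1 (x + v))) B"
    by (simp add: distr_rotation)
  also have "\<dots> = emeasure torus {x \<in> space torus. mod1 (x + v) \<in> B}"
    by (subst emeasure_distr) (auto simp: vimage_def Int_def intro!: arg_cong2[where f = emeasure])
  finally show ?thesis by simp
qed

text \<open>
  Invariance is only required up to a null set, since the fibres to which this is applied are invariant in
  that sense alone. The measure of the set \<open>D w\<close> of points that the rotation by \<open>w\<close> carries across the
  boundary of \<open>A\<close> is subadditive in \<open>w\<close> and small for small \<open>w\<close>. It vanishes on the multiples of \<open>v\<close>,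
  which are dense modulo the integers, so it vanishes everywhere. By Fubini the product of the measures of
  \<open>A\<close> and its complement is the mean over \<open>w\<close> of the measure of the points of \<open>A\<close> that \<open>w\<close> moves out of
  \<open>A\<close>, which is 0.
\<close>
lemma rotation_ergodic:
  fixes v :: "real^'n"
  assumes v: "totally_irrational v" and A [measurable]: "A \<in> sets torus"
    and inv: "emeasure torus {x \<in> space torus. (mod1 (x + v) \<in> A) \<noteq> (x \<in> A)} = 0"
  shows "A \<in> null_sets torus \<or> space torus - A \<in> null_sets torus"
proof -
  define D where "D w = {x \<in> space torus. (mod1 (x + w) \<in> A) \<noteq> (x \<in> A)}" for w
  have D [measurable]: "D w \<in> sets torus" for w
    unfolding D_def by measurable
  have D_add: "emeasure torus (D (w + w')) \<le> emeasure torus (D w) + emeasure torus (D w')" for w w'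
  proof -
    have "D (w + w') \<subseteq> D w \<union> {x \<in> space torus. mod1 (x + w) \<in> D w'}"
      by (auto simp: D_def add.assoc)
    then have "emeasure torus (D (w + w')) \<le> emeasure torus (D w \<union> {x \<in> space torus. mod1 (x + w) \<in> D w'})"
      by (intro emeasure_mono) measurable
    also have "\<dots> \<le> emeasure torus (D w) + emeasure torus {x \<in> space torus. mod1 (x + w) \<in> D w'}"
      by (intro emeasure_subadditive) measurable
    finally show ?thesis by (simp add: emeasure_rotation_vimage)
  qed
  have D_uminus: "emeasure torus (D (- w)) = emeasure torus (D w)" for w
  proof -
    have "D (- w) = {x \<in> space torus. mod1 (x + - w) \<in> D w}"
      by (auto simp: D_def mod1_torus)
    then show ?thesis by (simp only: emeasure_rotation_vimage D)
  qed
  have D_nat: "emeasure torus (D (real k *\<^sub>R v)) = 0" for k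
  proof (induction k)
    case 0
    have "D 0 = {}" by (auto simp: D_def mod1_torus)
    then show ?case by simp
  next
    case (Suc k)
    moreover have "emeasure torus (D v) = 0" using inv by (simp only: D_def)
    ultimately show ?case using D_add[of "real k *\<^sub>R v" v]
      by (simp add: scaleR_add_left add.commute)
  qed
  have D_int: "emeasure torus (D (of_int k *\<^sub>R v)) = 0" for k :: int
    using D_nat[of "nat k"] D_nat[of "nat (- k)"] D_uminus[of "real (nat (- k)) *\<^sub>R v"]
    by (cases "k \<ge> 0") auto
  have D_0: "emeasure torus (D w) = 0" for w
  proof (rule ccontr)
    assume "emeasure torus (D w) \<noteq> 0"
    moreover interpret prob_space "torus :: (real^'n) measure" by (rule prob_space_torus)
    define e where "e = measure torus (D w)"
    ultimately have e: "e > 0" "ennreal e \<le> emeasure torus (D w)"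
      by (simp_all add: emeasure_eq_measure zero_less_measure_iff)
    from rotation_defect_small[OF A e(1)] obtain d where d: "d > 0"
      "\<And>h. norm h < d \<Longrightarrow> emeasure torus (D h) < ennreal e"
      unfolding D_def by blast
    obtain k :: int and m :: "'n \<Rightarrow> int" where
      km: "\<And>i. \<bar>of_int k * v $ i - of_int (m i) - w $ i\<bar> < d / real CARD('n)"
      using multiples_dense_mod_integers[OF v, of "d / real CARD('n)" w] d(1) by auto
    define r :: "real^'n" where "r = (\<chi> i. w $ i - of_int k * v $ i + of_int (m i))"
    have "norm r \<le> (\<Sum>i\<in>UNIV. \<bar>r $ i\<bar>)" by (rule norm_le_l1_cart)
    also have "\<dots> < of_nat (card (UNIV :: 'n set)) * (d / real CARD('n))"
      by (rule sum_bounded_above_strict) (use km in \<open>auto simp: r_def abs_less_iff algebra_simps\<close>)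
    also have "\<dots> = d" by simp
    finally have r: "emeasure torus (D r) < ennreal e" by (rule d(2))
    have "mod1 (x + w) = mod1 (x + (of_int k *\<^sub>R v + r))" for x
      by (simp add: mod1_def r_def vec_eq_iff flip: add.assoc)
    then have "D w = D (of_int k *\<^sub>R v + r)" by (simp add: D_def)
    then have "emeasure torus (D w) \<le> emeasure torus (D r)"
      using D_add[of "of_int k *\<^sub>R v" r] D_int[of k] by simp
    with r e(2) show False by simp
  qed
  interpret prob_space "torus :: (real^'n) measure" by (rule prob_space_torus)
  interpret TT: pair_prob_space "torus :: (real^'n) measure" "torus :: (real^'n) measure" ..
  define X where "X = {z \<in> space (torus \<Otimes>\<^sub>M torus). snd z \<in> A \<and> mod1 (snd z + fst z) \<in> space torus - A}"
  have [measurable]: "fst \<in> borel_measurable ((torus :: (real^'n) measure) \<Otimes>\<^sub>M (torus :: (real^'n) measure))"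
    by (rule measurable_torus_borel) measurable
  have X [measurable]: "X \<in> sets (torus \<Otimes>\<^sub>M torus)"
    unfolding X_def by measurable
  have "emeasure (torus \<Otimes>\<^sub>M torus) X = (\<integral>\<^sup>+w. emeasure torus (Pair w -` X) \<partial>torus)"
    by (rule emeasure_pair_measure_alt) measurable
  also have "\<dots> = (\<integral>\<^sup>+(w :: real^'n). 0 \<partial>torus)"
  proof (intro nn_integral_cong)
    fix w :: "real^'n"
    have "emeasure torus (Pair w -` X) \<le> emeasure torus (D w)"
      by (intro emeasure_mono) (auto simp: X_def D_def space_pair_measure)
    with D_0 show "emeasure torus (Pair w -` X) = 0" by simp
  qed
  also have "\<dots> = 0" by simp
  finally have "emeasure (torus \<Otimes>\<^sub>M torus) X = 0" .
  moreover have "emeasure (torus \<Otimes>\<^sub>M torus) X = (\<integral>\<^sup>+x. emeasure torus ((\<lambda>w. (w, x)) -` X) \<partial>torus)"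
    by (rule TT.emeasure_pair_measure_alt2) measurable
  moreover have "\<dots> = (\<integral>\<^sup>+x. emeasure torus (space torus - A) * indicator A x \<partial>torus)"
  proof (intro nn_integral_cong)
    fix x :: "real^'n" assume "x \<in> space torus"
    then have "(\<lambda>w. (w, x)) -` X = (if x \<in> A then {w \<in> space torus. mod1 (w + x) \<in> space torus - A} else {})"
      by (auto simp: X_def space_pair_measure add.commute)
    then show "emeasure torus ((\<lambda>w. (w, x)) -` X) = emeasure torus (space torus - A) * indicator A x"
      by (simp add: emeasure_rotation_vimage del: Diff_iff)
  qed
  moreover have "\<dots> = emeasure torus (space torus - A) * emeasure torus A"
    by (rule nn_integral_cmult_indicator) measurable
  ultimately show ?thesis
    by (auto simp: null_sets_def)
qed

section \<open>Essential values of compact extensions\<close>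

lemma pair_prob_space_torus:
  "pair_prob_space (torus :: (real^'m) measure) (torus :: (real^'n) measure)"
  by (simp add: pair_prob_space_def pair_sigma_finite_def prob_space_torus prob_space_imp_sigma_finite)

lemma compact_extension_apply [simp]:
  "compact_extension v \<phi> (x, y) = (mod1 (x + v), mod1 (y + \<phi> x))"
  by (simp add: compact_extension_def)

lemma compact_extension_measurable [measurable]:
  fixes \<phi> :: "real^2 \<Rightarrow> real^'d"
  assumes [measurable]: "\<phi> \<in> borel_measurable torus"
  shows "compact_extension v \<phi> \<in> measurable (torus \<Otimes>\<^sub>M torus) (torus \<Otimes>\<^sub>M torus)"
  unfolding compact_extension_def by measurable

text \<open>
  Fibre by fibre the map is a rotation, and so is its action on the base.
\<close>
lemma distr_compact_extension:
  fixes \<phi> :: "real^2 \<Rightarrow> real^'d"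
  assumes \<phi> [measurable]: "\<phi> \<in> borel_measurable torus"
  shows "distr (torus \<Otimes>\<^sub>M torus) (torus \<Otimes>\<^sub>M torus) (compact_extension v \<phi>) = torus \<Otimes>\<^sub>M torus"
proof (rule measure_eqI)
  fix A :: "((real^2) \<times> (real^'d)) set"
  assume "A \<in> sets (distr (torus \<Otimes>\<^sub>M torus) (torus \<Otimes>\<^sub>M torus) (compact_extension v \<phi>))"
  then have A [measurable]: "A \<in> sets (torus \<Otimes>\<^sub>M torus)" by simp
  interpret pair_prob_space "torus :: (real^2) measure" "torus :: (real^'d) measure"
    by (rule pair_prob_space_torus)
  have "emeasure (distr (torus \<Otimes>\<^sub>M torus) (torus \<Otimes>\<^sub>M torus) (compact_extension v \<phi>)) A
      = emeasure (torus \<Otimes>\<^sub>M torus) (compact_extension v \<phi> -` A \<inter> space (torus \<Otimes>\<^sub>M torus))"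
    by (rule emeasure_distr) measurable
  also have "\<dots> = (\<integral>\<^sup>+x. emeasure torus (Pair x -` (compact_extension v \<phi> -` A \<inter> space (torus \<Otimes>\<^sub>M torus))) \<partial>torus)"
    by (rule M2.emeasure_pair_measure_alt) measurable
  also have "\<dots> = (\<integral>\<^sup>+x. emeasure torus (Pair (mod1 (x + v)) -` A) \<partial>torus)"
  proof (intro nn_integral_cong)
    fix x :: "real^2" assume "x \<in> space torus"
    then have "Pair x -` (compact_extension v \<phi> -` A \<inter> space (torus \<Otimes>\<^sub>M torus))
       = {y \<in> space torus. mod1 (y + \<phi> x) \<in> Pair (mod1 (x + v)) -` A}"
      by (auto simp: space_pair_measure)
    then show "emeasure torus (Pair x -` (compact_extension v \<phi> -` A \<inter> space (torus \<Otimes>\<^sub>M torus)))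
        = emeasure torus (Pair (mod1 (x + v)) -` A)"
      by (simp add: emeasure_rotation_vimage sets_Pair1[OF A] del: vimage_eq)
  qed
  also have "\<dots> = (\<integral>\<^sup>+x. emeasure torus (Pair x -` A) \<partial>distr torus torus (\<lambda>x. mod1 (x + v)))"
    by (subst nn_integral_distr) (auto intro: M2.measurable_emeasure_Pair)
  also have "\<dots> = emeasure (torus \<Otimes>\<^sub>M torus) A"
    by (simp add: distr_rotation M2.emeasure_pair_measure_alt)
  finally show "emeasure (distr (torus \<Otimes>\<^sub>M torus) (torus \<Otimes>\<^sub>M torus) (compact_extension v \<phi>)) A
    = emeasure (torus \<Otimes>\<^sub>M torus) A" .
qed simp

definition birkhoff_sum :: "real^2 \<Rightarrow> (real^2 \<Rightarrow> 'a::comm_monoid_add) \<Rightarrow> nat \<Rightarrow> real^2 \<Rightarrow> 'a" where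
  "birkhoff_sum \<alpha> \<phi> n x = (\<Sum>i<n. \<phi> (mod1 (x + real i *\<^sub>R \<alpha>)))"

text \<open>
  The iterates are again compact extensions, so the results on a single step apply to them.
\<close>
lemma compact_extension_iterate:
  assumes "x \<in> space torus" "y \<in> space torus"
  shows "(compact_extension \<alpha> \<phi> ^^ n) (x, y)
    = compact_extension (real n *\<^sub>R \<alpha>) (birkhoff_sum \<alpha> \<phi> n) (x, y)"
  by (induction n) (use assms in \<open>simp_all add: birkhoff_sum_def mod1_torus algebra_simps\<close>)

lemma invariant_set_iterate:
  assumes "T -` A \<inter> M = A" "T \<in> M \<rightarrow> M" "z \<in> M"
  shows "(T ^^ n) z \<in> A \<longleftrightarrow> z \<in> A"
proof -
  have "(T ^^ n) z \<in> M" for n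
    by (induction n) (use assms in auto)
  then have "(T ^^ Suc n) z \<in> A \<longleftrightarrow> (T ^^ n) z \<in> A" for n
    using assms(1) by auto
  then show ?thesis by (induction n) auto
qed

text \<open>
  The key step: a jump \<open>b\<close> of the Birkhoff sums that occurs between arbitrarily close points, with
  probability bounded below, is a period of every invariant set in the fibre direction. In the proof,
  \<open>B\<close> is the set where this periodicity fails, \<open>G\<close> measures its fibres, and \<open>D v\<close> is the set where
  translating the base point by \<open>v\<close> changes membership in \<open>A\<close>.
\<close>
lemma invariant_under_essential_value:
  fixes \<phi> :: "real^2 \<Rightarrow> real^'d"
  assumes \<alpha>: "totally_irrational \<alpha>"
    and \<phi> [measurable]: "\<phi> \<in> borel_measurable torus"
    and A [measurable]: "A \<in> sets (torus \<Otimes>\<^sub>M torus)"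
    and inv: "compact_extension \<alpha> \<phi> -` A \<inter> space (torus \<Otimes>\<^sub>M torus) = A"
    and h: "h \<longlonglongrightarrow> 0"
    and \<delta>: "\<delta> > 0"
    and E [measurable]: "\<And>n. E n \<in> sets torus"
    and E_large: "\<And>n. emeasure torus (E n) \<ge> ennreal \<delta>"
    and E_jump: "\<And>n x. x \<in> E n \<Longrightarrow>
          birkhoff_sum \<alpha> \<phi> (k n) (mod1 (x + h n)) = birkhoff_sum \<alpha> \<phi> (k n) x + b"
  shows "AE x in torus. emeasure torus {y \<in> space torus. ((x, mod1 (y + b)) \<in> A) \<noteq> ((x, y) \<in> A)} = 0"
proof -
  interpret pair_prob_space "torus :: (real^2) measure" "torus :: (real^'d) measure"
    by (rule pair_prob_space_torus)
  let ?M = "(torus :: (real^2) measure) \<Otimes>\<^sub>M (torus :: (real^'d) measure)"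
  have E_sub: "E n \<subseteq> space torus" for n
    using sets.sets_into_space[OF E] .
  have iter: "(mod1 (x + real n *\<^sub>R \<alpha>), mod1 (y + birkhoff_sum \<alpha> \<phi> n x)) \<in> A \<longleftrightarrow> (x, y) \<in> A"
    if "x \<in> space torus" "y \<in> space torus" for x y n
  proof -
    have "(compact_extension \<alpha> \<phi> ^^ n) (x, y) \<in> A \<longleftrightarrow> (x, y) \<in> A"
      by (rule invariant_set_iterate[OF inv]) (use that in \<open>auto simp: space_pair_measure\<close>)
    then show ?thesis using compact_extension_iterate[OF that, where \<alpha> = \<alpha> and \<phi> = \<phi> and n = n] by simp
  qed
  have [measurable]: "birkhoff_sum \<alpha> \<phi> n \<in> borel_measurable torus" for n
    unfolding birkhoff_sum_def by measurable
  define B where "B = {z \<in> space ?M. ((fst z, mod1 (snd z + b)) \<in> A) \<noteq> (z \<in> A)}"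
  have B [measurable]: "B \<in> sets ?M" unfolding B_def by measurable
  define D where "D v = {z \<in> space ?M. ((mod1 (fst z + v), snd z) \<in> A) \<noteq> (z \<in> A)}" for v
  have D [measurable]: "D v \<in> sets ?M" for v unfolding D_def by measurable
  define G where "G x = emeasure torus (Pair x -` B)" for x
  have G [measurable]: "G \<in> borel_measurable torus"
    unfolding G_def by (rule M2.measurable_emeasure_Pair) measurable
  have Pair_B: "Pair x -` B = {y \<in> space torus. ((x, mod1 (y + b)) \<in> A) \<noteq> ((x, y) \<in> A)}"
    if "x \<in> space torus" for x
    using that by (auto simp: B_def space_pair_measure)

  have main: "emeasure ?M (B \<inter> E n \<times> space torus) \<le> 2 * emeasure ?M (D (h n))" for n
  proof -
    \<comment> \<open>\<open>?\<Psi>\<close> is the iterate applied to \<open>(x, y + b)\<close>. The iterates of \<open>(x, y + b)\<close> and of \<open>(x + h, y)\<close>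
      differ only by \<open>h\<close> in the base. So if \<open>(x, y + b)\<close> and \<open>(x, y)\<close> disagree about \<open>A\<close>,
      then either \<open>(x + h, y)\<close> disagrees with \<open>(x, y)\<close>, or the two iterates disagree with each other.\<close>
    let ?\<Psi> = "compact_extension (real (k n) *\<^sub>R \<alpha>) (\<lambda>x. birkhoff_sum \<alpha> \<phi> (k n) x + b)"
    have "B \<inter> E n \<times> space torus \<subseteq> D (h n) \<union> (?\<Psi> -` D (h n) \<inter> space ?M)"
    proof
      fix z assume z: "z \<in> B \<inter> E n \<times> space torus"
      obtain x y where [simp]: "z = (x, y)" by (cases z)
      have xE: "x \<in> E n" and x: "x \<in> space torus" and y: "y \<in> space torus"
        and xy: "((x, mod1 (y + b)) \<in> A) \<noteq> ((x, y) \<in> A)"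
        using z E_sub by (auto simp: B_def)
      define S where "S = birkhoff_sum \<alpha> \<phi> (k n) x + b"
      have "(mod1 (mod1 (x + h n) + real (k n) *\<^sub>R \<alpha>), mod1 (y + S)) \<in> A \<longleftrightarrow> (mod1 (x + h n), y) \<in> A"
        using iter[of "mod1 (x + h n)" y "k n"] y E_jump[OF xE] by (simp add: S_def)
      moreover have "(mod1 (x + real (k n) *\<^sub>R \<alpha>), mod1 (y + S)) \<in> A \<longleftrightarrow> (x, mod1 (y + b)) \<in> A"
        using iter[of x "mod1 (y + b)" "k n"] x by (simp add: S_def algebra_simps)
      moreover have "mod1 (mod1 (x + h n) + real (k n) *\<^sub>R \<alpha>) = mod1 (mod1 (x + real (k n) *\<^sub>R \<alpha>) + h n)"
        by (simp add: algebra_simps)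
      ultimately show "z \<in> D (h n) \<union> (?\<Psi> -` D (h n) \<inter> space ?M)"
        using xy x y by (auto simp: D_def space_pair_measure S_def)
    qed
    then have "emeasure ?M (B \<inter> E n \<times> space torus) \<le> emeasure ?M (D (h n) \<union> (?\<Psi> -` D (h n) \<inter> space ?M))"
      by (intro emeasure_mono) measurable
    also have "\<dots> \<le> emeasure ?M (D (h n)) + emeasure ?M (?\<Psi> -` D (h n) \<inter> space ?M)"
      by (intro emeasure_subadditive) measurable
    also have "emeasure ?M (?\<Psi> -` D (h n) \<inter> space ?M) = emeasure (distr ?M ?M ?\<Psi>) (D (h n))"
      by (rule emeasure_distr[symmetric]) measurable
    also have "\<dots> = emeasure ?M (D (h n))"
      by (subst distr_compact_extension) auto
    finally show ?thesis by (simp add: mult_2)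
  qed

  \<comment> \<open>Each horizontal slice of \<open>A\<close> is moved little by a small translation; integrate over the slices by
    dominated convergence.\<close>
  have D_lim: "(\<lambda>n. emeasure ?M (D (h n))) \<longlonglongrightarrow> 0"
  proof -
    have "(\<lambda>n. \<integral>\<^sup>+y. emeasure torus ((\<lambda>x. (x, y)) -` D (h n)) \<partial>(torus :: (real^'d) measure)) \<longlonglongrightarrow> (\<integral>\<^sup>+y. 0 \<partial>(torus :: (real^'d) measure))"
    proof (rule nn_integral_dominated_convergence[where w = "\<lambda>_. 1"])
      show "(\<lambda>y. emeasure torus ((\<lambda>x. (x, y)) -` D (h n))) \<in> borel_measurable torus" for n
        by (rule measurable_emeasure_Pair2[OF D])
      show "AE y in torus. (\<lambda>n. emeasure torus ((\<lambda>x. (x, y)) -` D (h n))) \<longlonglongrightarrow> 0"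
      proof (rule AE_I2)
        fix y :: "real^'d" assume y: "y \<in> space torus"
        have slice: "(\<lambda>x. (x, y)) -` A \<in> sets torus"
          using sets_Pair2[OF A] .
        have slice_D: "(\<lambda>x. (x, y)) -` D v = {x \<in> space torus. (mod1 (x + v) \<in> (\<lambda>x. (x, y)) -` A) \<noteq> (x \<in> (\<lambda>x. (x, y)) -` A)}" for v
          using y by (auto simp: D_def space_pair_measure)
        show "(\<lambda>n. emeasure torus ((\<lambda>x. (x, y)) -` D (h n))) \<longlonglongrightarrow> 0"
        proof (rule order_tendstoI)
          fix e :: ennreal assume "0 < e"
          then obtain r where r: "r > 0" "ennreal r \<le> e"
            by (cases e) (auto intro: that[of 1])
          obtain d where d: "d > 0" "\<And>v. norm v < d \<Longrightarrow> emeasure torus ((\<lambda>x. (x, y)) -` D v) < ennreal r"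
            using rotation_defect_small[OF slice r(1)] unfolding slice_D by blast
          have "eventually (\<lambda>n. norm (h n) < d) sequentially"
            using tendsto_norm[OF h] d(1) by (auto intro: order_tendstoD)
          then show "eventually (\<lambda>n. emeasure torus ((\<lambda>x. (x, y)) -` D (h n)) < e) sequentially"
            by eventually_elim (use d(2) r(2) in \<open>auto intro: less_le_trans\<close>)
        qed simp
      qed
      show "AE y in torus. emeasure torus ((\<lambda>x. (x, y)) -` D (h n)) \<le> 1" for n
        by (simp add: M1.emeasure_le_1)
      show "(\<integral>\<^sup>+y. 1 \<partial>(torus :: (real^'d) measure)) < \<infinity>"
        by (simp add: M2.emeasure_space_1)
    qed auto
    then show ?thesis by (simp add: emeasure_pair_measure_alt2)
  qed

  have G_inv: "G (mod1 (x + \<alpha>)) = G x" if x: "x \<in> space torus" for x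
  proof -
    have step: "(mod1 (x + \<alpha>), mod1 (y + \<phi> x)) \<in> A \<longleftrightarrow> (x, y) \<in> A" if "y \<in> space torus" for y
      using iter[OF x that, of 1] x by (simp add: birkhoff_sum_def mod1_torus)
    have "Pair x -` B = {y \<in> space torus. mod1 (y + \<phi> x) \<in> Pair (mod1 (x + \<alpha>)) -` B}"
      using step step[of "mod1 (_ + b)"] x
      by (auto simp: Pair_B algebra_simps)
    then show ?thesis
      unfolding G_def by (simp add: emeasure_rotation_vimage sets_Pair1[OF B] del: vimage_eq)
  qed

  \<comment> \<open>The superlevel sets of the invariant function \<open>G\<close> are null or conull. A conull one would give
    \<open>B\<close> measure at least \<open>t * \<delta>\<close> over every \<open>E n\<close>.\<close>
  have G_level: "{x \<in> space torus. ennreal t \<le> G x} \<in> null_sets torus" if t: "t > 0" for t :: real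
  proof (rule ccontr)
    let ?H = "{x \<in> space (torus :: (real^2) measure). ennreal t \<le> G x}"
    assume "?H \<notin> null_sets torus"
    moreover have "{x \<in> space torus. (mod1 (x + \<alpha>) \<in> ?H) \<noteq> (x \<in> ?H)} = {}"
      using G_inv by auto
    then have "emeasure torus {x \<in> space torus. (mod1 (x + \<alpha>) \<in> ?H) \<noteq> (x \<in> ?H)} = 0"
      by (simp only: emeasure_empty)
    ultimately have "space torus - ?H \<in> null_sets torus"
      using rotation_ergodic[OF \<alpha>, of ?H] by simp
    then have AE_G: "AE x in torus. ennreal t \<le> G x"
      by (rule AE_I') auto
    have "ennreal t * ennreal \<delta> \<le> 2 * emeasure ?M (D (h n))" for n
    proof -
      have "ennreal t * ennreal \<delta> \<le> ennreal t * emeasure torus (E n)"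
        by (intro mult_left_mono E_large) simp
      also have "\<dots> = (\<integral>\<^sup>+x. ennreal t * indicator (E n) x \<partial>torus)"
        by (rule nn_integral_cmult_indicator[symmetric]) measurable
      also have "\<dots> \<le> (\<integral>\<^sup>+x. emeasure torus (Pair x -` (B \<inter> E n \<times> space torus)) \<partial>torus)"
      proof (rule nn_integral_mono_AE, use AE_G in eventually_elim)
        fix x assume "ennreal t \<le> G x"
        moreover have "Pair x -` (B \<inter> E n \<times> space torus) = Pair x -` B" if "x \<in> E n"
          using that by (auto simp: B_def space_pair_measure)
        ultimately show "ennreal t * indicator (E n) x \<le> emeasure torus (Pair x -` (B \<inter> E n \<times> space torus))"
          by (auto simp: G_def split: split_indicator)
      qed
      also have "\<dots> = emeasure ?M (B \<inter> E n \<times> space torus)"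
        by (rule M2.emeasure_pair_measure_alt[symmetric]) measurable
      also have "\<dots> \<le> 2 * emeasure ?M (D (h n))" by (rule main)
      finally show ?thesis .
    qed
    moreover have "(\<lambda>n. 2 * emeasure ?M (D (h n))) \<longlonglongrightarrow> 2 * 0"
      by (intro tendsto_mult_ennreal D_lim) auto
    ultimately have "ennreal t * ennreal \<delta> \<le> 2 * 0"
      by (intro LIMSEQ_le_const) auto
    then show False using t \<delta> by (simp flip: ennreal_mult)
  qed
  have "AE x in torus. \<forall>n. \<not> ennreal (1 / real (Suc n)) \<le> G x"
    unfolding AE_all_countable
  proof
    fix n
    show "AE x in torus. \<not> ennreal (1 / real (Suc n)) \<le> G x"
      by (rule AE_I'[OF G_level[of "1 / real (Suc n)"]]) auto
  qed
  with AE_space show ?thesis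
  proof eventually_elim
    fix x :: "real^2" assume x: "x \<in> space torus" and small: "\<forall>n. \<not> ennreal (1 / real (Suc n)) \<le> G x"
    have "G x = 0"
    proof (rule ccontr)
      assume "G x \<noteq> 0"
      moreover have G_real: "G x = ennreal (measure torus (Pair x -` B))"
        by (simp add: G_def M2.emeasure_eq_measure)
      ultimately obtain n where "1 / real (Suc n) < measure torus (Pair x -` B)"
        using nat_approx_posE[of "measure torus (Pair x -` B)"] by (auto simp: zero_less_measure_iff)
      then show False using small G_real by (metis ennreal_leI less_imp_le)
    qed
    then show "emeasure torus {y \<in> space torus. ((x, mod1 (y + b)) \<in> A) \<noteq> ((x, y) \<in> A)} = 0"
      by (simp add: G_def Pair_B[OF x])
  qed
qed

text \<open>
  Almost every fibre is invariant under the ergodic rotation by \<open>b\<close>, hence null or conull; which of the two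
  happens is decided by the invariant function \<open>g\<close> of the base point.
\<close>
lemma ergodic_if_totally_irrational_essential_value:
  fixes \<phi> :: "real^2 \<Rightarrow> real^'d"
  assumes \<alpha>: "totally_irrational \<alpha>"
    and b: "totally_irrational b"
    and \<phi> [measurable]: "\<phi> \<in> borel_measurable torus"
    and h: "h \<longlonglongrightarrow> 0"
    and \<delta>: "\<delta> > 0"
    and E: "\<And>n. E n \<in> sets torus"
    and E_large: "\<And>n. emeasure torus (E n) \<ge> ennreal \<delta>"
    and E_jump: "\<And>n x. x \<in> E n \<Longrightarrow>
          birkhoff_sum \<alpha> \<phi> (k n) (mod1 (x + h n)) = birkhoff_sum \<alpha> \<phi> (k n) x + b"
  shows "ergodic (torus \<Otimes>\<^sub>M torus) (compact_extension \<alpha> \<phi>)"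
  unfolding ergodic_def
proof (intro conjI ballI impI)
  interpret pair_prob_space "torus :: (real^2) measure" "torus :: (real^'d) measure"
    by (rule pair_prob_space_torus)
  let ?M = "(torus :: (real^2) measure) \<Otimes>\<^sub>M (torus :: (real^'d) measure)"
  show "compact_extension \<alpha> \<phi> \<in> measurable ?M ?M" by measurable
  show "distr ?M ?M (compact_extension \<alpha> \<phi>) = ?M" by (rule distr_compact_extension) fact
  fix A assume A [measurable]: "A \<in> sets ?M" and inv: "compact_extension \<alpha> \<phi> -` A \<inter> space ?M = A"
  define g where "g x = emeasure torus (Pair x -` A)" for x
  have [measurable]: "g \<in> borel_measurable torus"
    unfolding g_def by (rule M2.measurable_emeasure_Pair) measurable
  have slice [measurable]: "Pair x -` A \<in> sets torus" for x
    by (rule sets_Pair1) measurable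
  have compl_slice: "Pair x -` (space ?M - A) = space torus - Pair x -` A" if "x \<in> space torus" for x
    using that by (auto simp: space_pair_measure)
  have dichotomy: "AE x in torus. g x = 0 \<or> emeasure torus (Pair x -` (space ?M - A)) = 0"
  proof -
    have "AE x in torus. emeasure torus {y \<in> space torus. ((x, mod1 (y + b)) \<in> A) \<noteq> ((x, y) \<in> A)} = 0"
      by (rule invariant_under_essential_value[OF \<alpha> \<phi> A inv h \<delta>]) (fact E E_large E_jump)+
    with AE_space show ?thesis
    proof eventually_elim
      fix x assume x: "x \<in> space (torus :: (real^2) measure)"
        and "emeasure torus {y \<in> space torus. ((x, mod1 (y + b)) \<in> A) \<noteq> ((x, y) \<in> A)} = 0"
      then have "emeasure torus {y \<in> space torus. (mod1 (y + b) \<in> Pair x -` A) \<noteq> (y \<in> Pair x -` A)} = 0"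
        by simp
      from rotation_ergodic[OF b slice this]
      show "g x = 0 \<or> emeasure torus (Pair x -` (space ?M - A)) = 0"
        by (auto simp: g_def compl_slice[OF x])
    qed
  qed
  have g_inv: "g (mod1 (x + \<alpha>)) = g x" if x: "x \<in> space torus" for x
  proof -
    have "(mod1 (x + \<alpha>), mod1 (y + \<phi> x)) \<in> A \<longleftrightarrow> (x, y) \<in> A" if "y \<in> space torus" for y
    proof -
      have "(x, y) \<in> space ?M" using x that by (simp add: space_pair_measure)
      then show ?thesis using inv by (auto simp: set_eq_iff)
    qed
    moreover have "Pair x -` A \<subseteq> space torus"
      using sets.sets_into_space[OF slice] .
    ultimately have "Pair x -` A = {y \<in> space torus. mod1 (y + \<phi> x) \<in> Pair (mod1 (x + \<alpha>)) -` A}"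
      by auto
    then show ?thesis
      unfolding g_def by (simp add: emeasure_rotation_vimage slice del: vimage_eq)
  qed
  define H where "H = {x \<in> space torus. g x = 0}"
  have [measurable]: "H \<in> sets torus" unfolding H_def by measurable
  have "{x \<in> space torus. (mod1 (x + \<alpha>) \<in> H) \<noteq> (x \<in> H)} = {}"
    using g_inv by (auto simp: H_def)
  then have "emeasure torus {x \<in> space torus. (mod1 (x + \<alpha>) \<in> H) \<noteq> (x \<in> H)} = 0"
    by (simp only: emeasure_empty)
  from rotation_ergodic[OF \<alpha> _ this] consider "H \<in> null_sets torus" | "space torus - H \<in> null_sets torus"
    by auto
  then show "A \<in> null_sets ?M \<or> space ?M - A \<in> null_sets ?M"
  proof cases
    case 1
    have "AE x in torus. x \<notin> H" by (rule AE_not_in) fact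
    with dichotomy AE_space have "AE x in torus. emeasure torus (Pair x -` (space ?M - A)) = 0"
      by eventually_elim (auto simp: H_def)
    then have "(\<integral>\<^sup>+x. emeasure torus (Pair x -` (space ?M - A)) \<partial>torus) = (\<integral>\<^sup>+(x::real^2). 0 \<partial>torus)"
      by (rule nn_integral_cong_AE)
    then have "emeasure ?M (space ?M - A) = 0"
      by (subst M2.emeasure_pair_measure_alt) auto
    then show ?thesis by (auto simp: null_sets_def)
  next
    case 2
    have "AE x in torus. g x = 0"
      by (rule AE_I'[OF 2]) (auto simp: H_def)
    then have "(\<integral>\<^sup>+x. g x \<partial>torus) = (\<integral>\<^sup>+(x::real^2). 0 \<partial>torus)"
      by (rule nn_integral_cong_AE)
    then have "emeasure ?M A = 0"
      by (subst M2.emeasure_pair_measure_alt) (auto simp: g_def)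
    then show ?thesis by (auto simp: null_sets_def)
  qed
qed

section \<open>Counting passages through the integers\<close>

text \<open>
  For \<open>0 \<le> s < 1\<close> this indicates that the interval from \<open>t\<close> to \<open>t + s\<close>, without \<open>t\<close> itself, contains an
  integer; it is real-valued so that it can be summed and integrated.
\<close>
definition wraps :: "real \<Rightarrow> real \<Rightarrow> real" where
  "wraps s t = (if 1 - s \<le> frac t then 1 else 0)"

lemma wraps_bounds: "0 \<le> wraps s t" "wraps s t \<le> 1"
  by (simp_all add: wraps_def)

lemma wraps_measurable [measurable]: "wraps s \<in> borel_measurable borel"
  unfolding wraps_def frac_def by measurable

lemma frac_add_eq_wraps:
  assumes "0 \<le> s" "s < 1"
  shows "frac (t + s) = frac t + s - wraps s t"
proof -
  have "frac s = s" using assms by (simp add: frac_eq)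
  then show ?thesis by (auto simp: frac_add wraps_def)
qed

text \<open>
  The intervals between consecutive points \<open>t + k / m\<close> make up one full turn. In terms of
  \<open>frac_add_eq_wraps\<close> the sum telescopes.
\<close>
lemma sum_wraps_equidistant:
  assumes "m \<ge> 2"
  shows "(\<Sum>k<m. wraps (1 / real m) (t + real k / real m)) = 1"
proof -
  define f where "f k = frac (t + real k / real m)" for k
  have "wraps (1 / real m) (t + real k / real m) = 1 / real m - (f (Suc k) - f k)" for k
    using frac_add_eq_wraps[of "1 / real m" "t + real k / real m"] assms
    by (simp add: f_def add_divide_distrib algebra_simps)
  then have "(\<Sum>k<m. wraps (1 / real m) (t + real k / real m)) = real m * (1 / real m) - (\<Sum>k<m. f (Suc k) - f k)"
    by (simp add: sum_subtractf)
  also have "(\<Sum>k<m. f (Suc k) - f k) = f m - f 0"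
    by (rule sum_lessThan_telescope)
  also have "f m = f 0"
    using assms by (simp add: f_def frac_1_eq)
  finally show ?thesis using assms by simp
qed

lemma badly_approximable_uminus: "badly_approximable \<theta> \<Longrightarrow> badly_approximable (- \<theta>)"
proof -
  assume "badly_approximable \<theta>"
  then obtain c where c: "c > 0" "\<And>q::int. q \<noteq> 0 \<Longrightarrow> infdist (of_int q * \<theta>) \<int> \<ge> c / of_int \<bar>q\<bar>"
    unfolding badly_approximable_def by blast
  have "infdist (of_int q * - \<theta>) \<int> \<ge> c / of_int \<bar>q\<bar>" if "q \<noteq> 0" for q :: int
    using c(2)[of "- q"] that by simp
  with c(1) show ?thesis unfolding badly_approximable_def by blast
qed

text \<open>
  Two passages at times \<open>i < j < n\<close> within a window of length \<open>1 / (K n)\<close> would bring \<open>(j - i) \<theta>\<close> within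
  \<open>1 / (K n)\<close> of an integer. Here \<open>K \<ge> 2\<close> keeps the lower bound \<open>1 / K - 1 / K\<^sup>2\<close> of
  \<open>prob_single_crossing\<close> positive.
\<close>
lemma badly_approximable_wraps_once:
  assumes "badly_approximable \<theta>"
  obtains K :: nat where "K \<ge> 2"
    "\<And>n t. n > 0 \<Longrightarrow> (\<Sum>i<n. wraps (1 / real (K * n)) (t + real i * \<theta>)) \<le> 1"
proof -
  obtain c where c: "c > 0" "\<And>q::int. q \<noteq> 0 \<Longrightarrow> infdist (of_int q * \<theta>) \<int> \<ge> c / of_int \<bar>q\<bar>"
    using assms unfolding badly_approximable_def by blast
  obtain K0 :: nat where K0: "1 / c < real K0" using reals_Archimedean2 by blast
  define K where "K = max 2 K0"
  have K: "K \<ge> 2" "1 / real K < c"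
  proof -
    show "K \<ge> 2" by (simp add: K_def)
    have "1 / c < real K" using K0 by (simp add: K_def)
    then show "1 / real K < c" using c(1) \<open>K \<ge> 2\<close> by (simp add: field_simps)
  qed
  have "(\<Sum>i<n. wraps (1 / real (K * n)) (t + real i * \<theta>)) \<le> 1" if n: "n > 0" for n t
  proof -
    define s where "s = 1 / real (K * n)"
    define I where "I = {i. i < n \<and> 1 - s \<le> frac (t + real i * \<theta>)}"
    have False if ij: "i \<in> I" "j \<in> I" "i < j" for i j
    proof -
      have "\<bar>frac (t + real j * \<theta>) - frac (t + real i * \<theta>)\<bar> < s"
        using ij frac_lt_1[of "t + real j * \<theta>"] frac_lt_1[of "t + real i * \<theta>"] by (auto simp: I_def)
      moreover define k where "k = \<lfloor>t + real j * \<theta>\<rfloor> - \<lfloor>t + real i * \<theta>\<rfloor>"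
      ultimately have "dist (of_int (int j - int i) * \<theta>) (of_int k) < s"
        by (simp add: dist_real_def frac_def algebra_simps)
      then have "infdist (of_int (int j - int i) * \<theta>) \<int> < s"
        using infdist_le[of "of_int k :: real" \<int> "of_int (int j - int i) * \<theta>"] by simp
      moreover have "infdist (of_int (int j - int i) * \<theta>) \<int> \<ge> c / of_int \<bar>int j - int i\<bar>"
        using c(2)[of "int j - int i"] ij by simp
      moreover have "c / real n \<le> c / of_int \<bar>int j - int i\<bar>"
        using ij c(1) by (intro divide_left_mono) (auto simp: I_def)
      moreover have "s \<le> c / real n"
        using K(2) n by (simp add: s_def field_simps)
      ultimately show False by simp
    qed
    then have "card I \<le> 1"
      by (subst One_nat_def, subst card_le_Suc0_iff_eq) (auto simp: I_def, metis linorder_neqE_nat)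
    moreover have "(\<Sum>i<n. wraps s (t + real i * \<theta>)) = real (card I)"
    proof -
      have "(\<Sum>i<n. wraps s (t + real i * \<theta>)) = (\<Sum>i\<in>I. 1)"
        by (rule sum.mono_neutral_cong_right) (auto simp: I_def wraps_def)
      then show ?thesis by simp
    qed
    ultimately show ?thesis by (simp add: s_def)
  qed
  with K(1) show thesis by (rule that)
qed

lemma integral_rotation:
  fixes f :: "real^'n \<Rightarrow> real"
  assumes "f \<in> borel_measurable torus"
  shows "(\<integral>x. f (mod1 (x + v)) \<partial>torus) = (\<integral>x. f x \<partial>torus)"
proof -
  have "(\<integral>x. f x \<partial>torus) = (\<integral>x. f x \<partial>distr torus torus (\<lambda>x. mod1 (x + v)))"
    by (simp add: distr_rotation)
  also have "\<dots> = (\<integral>x. f (mod1 (x + v)) \<partial>torus)"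
    by (rule integral_distr) (use assms in auto)
  finally show ?thesis by simp
qed

definition crossings :: "(real^2 \<Rightarrow> real) \<Rightarrow> real \<Rightarrow> real^2 \<Rightarrow> nat \<Rightarrow> real^2 \<Rightarrow> real" where
  "crossings l s \<alpha> n x = (\<Sum>i<n. wraps s (l x + real i * l \<alpha>))"

text \<open>
  The pair \<open>(p, q)\<close> is a system of coordinates on the two-dimensional torus: both functions descend to
  circle-valued maps, and \<open>u\<close>, \<open>u'\<close> is the dual basis. Translating along \<open>u'\<close> averages over \<open>q\<close> while \<open>p\<close>
  is fixed; this replaces a linear change of variables.
\<close>
locale torus_coordinates =
  fixes p q :: "real^2 \<Rightarrow> real" and u u' :: "real^2"
  assumes linear_p: "linear p" and linear_q: "linear q"
    and integral_p: "p (mod1 x) - p x \<in> \<int>" and integral_q: "q (mod1 x) - q x \<in> \<int>"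
    and dual [simp]: "p u = 1" "q u = 0" "p u' = 0" "q u' = 1"
begin

lemma swap: "torus_coordinates q p u' u"
  using linear_p linear_q integral_p integral_q dual by (simp add: torus_coordinates_def)

lemma q_measurable [measurable]: "q \<in> borel_measurable torus"
  by (intro borel_imp_torus borel_measurable_continuous_onI linear_continuous_on linear_conv_bounded_linear[THEN iffD1] linear_q)

lemma wraps_q_mod1: "wraps s (q (mod1 x) + t) = wraps s (q x + t)"
proof -
  have "frac (q (mod1 x) + t) = frac ((q x + t) + (q (mod1 x) - q x))" by (simp add: algebra_simps)
  also have "\<dots> = frac (q x + t)" by (rule frac_add_int_right) (rule integral_q)
  finally show ?thesis by (simp add: wraps_def)
qed

text \<open>
  Averaging over the \<open>m\<close> translations by multiples of \<open>u' / m\<close> leaves \<open>f\<close> unchanged and replaces the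
  indicator by the constant \<open>1 / m\<close>, by \<open>sum_wraps_equidistant\<close>. This is how the independence of \<open>p\<close> and
  \<open>q\<close> enters.
\<close>
lemma integral_times_wraps_q:
  fixes f :: "real^2 \<Rightarrow> real"
  assumes m: "m \<ge> 2"
    and f [measurable]: "f \<in> borel_measurable torus" and f_bound: "\<And>x. \<bar>f x\<bar> \<le> 1"
    and f_inv: "\<And>c x. f (mod1 (x + c *\<^sub>R u')) = f x"
  shows "(\<integral>x. f x * wraps (1 / real m) (q x + t) \<partial>torus) = (\<integral>x. f x \<partial>torus) / real m"
proof -
  interpret prob_space "torus :: (real^2) measure" by (rule prob_space_torus)
  have int: "integrable torus (\<lambda>x. f x * wraps (1 / real m) (q x + r))" for r
    by (rule integrable_const_bound[where B = 1])
      (auto simp: abs_mult wraps_bounds intro!: mult_le_one f_bound)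
  have shift: "(\<integral>x. f x * wraps (1 / real m) (q x + (t + r)) \<partial>torus)
      = (\<integral>x. f x * wraps (1 / real m) (q x + t) \<partial>torus)" for r
  proof -
    have "(\<integral>x. f x * wraps (1 / real m) (q x + t) \<partial>torus)
        = (\<integral>x. f (mod1 (x + r *\<^sub>R u')) * wraps (1 / real m) (q (mod1 (x + r *\<^sub>R u')) + t) \<partial>torus)"
      by (rule integral_rotation[symmetric]) measurable
    also have "\<dots> = (\<integral>x. f x * wraps (1 / real m) (q x + (t + r)) \<partial>torus)"
      by (simp only: f_inv wraps_q_mod1 linear_add[OF linear_q] linear_cmul[OF linear_q] dual) (simp add: ac_simps)
    finally show ?thesis by simp
  qed
  have "(\<integral>x. f x \<partial>torus) = (\<integral>x. (\<Sum>k<m. f x * wraps (1 / real m) (q x + (t + real k / real m))) \<partial>torus)"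
    using sum_wraps_equidistant[OF m, of "q _ + t"] by (simp add: add.assoc flip: sum_distrib_left)
  also have "\<dots> = (\<Sum>k<m. \<integral>x. f x * wraps (1 / real m) (q x + (t + real k / real m)) \<partial>torus)"
    by (rule Bochner_Integration.integral_sum) (rule int)
  also have "\<dots> = real m * (\<integral>x. f x * wraps (1 / real m) (q x + t) \<partial>torus)"
    by (simp add: shift)
  finally show ?thesis using m by (simp add: field_simps)
qed

lemma integral_wraps_q:
  assumes "m \<ge> 2"
  shows "(\<integral>x. wraps (1 / real m) (q x + t) \<partial>torus) = 1 / real m"
proof -
  interpret prob_space "torus :: (real^2) measure" by (rule prob_space_torus)
  show ?thesis using integral_times_wraps_q[OF assms, of "\<lambda>_. 1" t] by (simp add: prob_space)
qed

lemma integral_wraps_p_q: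
  assumes m: "m \<ge> 2"
  shows "(\<integral>x. wraps (1 / real m) (p x + t) * wraps (1 / real m) (q x + t') \<partial>torus) = 1 / (real m)\<^sup>2"
proof -
  interpret swap: torus_coordinates q p u' u by (rule swap)
  have "wraps s (p (mod1 (x + c *\<^sub>R u')) + t) = wraps s (p x + t)" for s c x
    by (simp add: swap.wraps_q_mod1 linear_add[OF linear_p] linear_cmul[OF linear_p])
  then have "(\<integral>x. wraps (1 / real m) (p x + t) * wraps (1 / real m) (q x + t') \<partial>torus)
     = (\<integral>x. wraps (1 / real m) (p x + t) \<partial>torus) / real m"
    by (intro integral_times_wraps_q[OF m]) (auto simp: wraps_bounds)
  then show ?thesis by (simp add: swap.integral_wraps_q[OF m] power2_eq_square)
qed

text \<open>
  With \<open>N\<^sub>p \<in> {0, 1}\<close> and \<open>N\<^sub>q\<close> the numbers of crossings, \<open>N\<^sub>p (1 - N\<^sub>q)\<close> is at most the indicator of the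
  event. Its integral is \<open>n / m - n\<^sup>2 / m\<^sup>2\<close> with \<open>m = K n\<close>.
\<close>
lemma prob_single_crossing:
  assumes K: "K \<ge> 2" and n: "n > 0"
    and once: "\<And>x. crossings p (1 / real (K * n)) \<alpha> n x \<le> 1"
  defines "s \<equiv> 1 / real (K * n)"
  shows "{x \<in> space torus. crossings p s \<alpha> n x = 1 \<and> crossings q s \<alpha> n x = 0} \<in> sets torus" (is "?E \<in> _")
    and "emeasure torus {x \<in> space torus. crossings p s \<alpha> n x = 1 \<and> crossings q s \<alpha> n x = 0}
       \<ge> ennreal (1 / real K - 1 / (real K)\<^sup>2)"
proof -
  interpret prob_space "torus :: (real^2) measure" by (rule prob_space_torus)
  interpret swap: torus_coordinates q p u' u by (rule swap)
  define m where "m = K * n"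
  have m: "m \<ge> 2" using K n by (simp add: m_def) (metis One_nat_def Suc_leI le_trans mult_le_mono2 nat_mult_1_right)
  have s: "s = 1 / real m" by (simp add: s_def m_def)
  have [measurable]: "crossings p s \<alpha> n \<in> borel_measurable torus" "crossings q s \<alpha> n \<in> borel_measurable torus"
    unfolding crossings_def by measurable
  show E [measurable]: "?E \<in> sets torus" by measurable
  have zero_or_ge_1: "crossings l s \<alpha> n x = 0 \<or> crossings l s \<alpha> n x \<ge> 1" for l x
  proof (cases "\<forall>i<n. wraps s (l x + real i * l \<alpha>) = 0")
    case True
    then show ?thesis by (simp add: crossings_def)
  next
    case False
    then obtain i where "i < n" "wraps s (l x + real i * l \<alpha>) = 1" by (auto simp: wraps_def split: if_splits)
    then have "crossings l s \<alpha> n x \<ge> 1"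
      unfolding crossings_def
      using member_le_sum[of i "{..<n}" "\<lambda>i. wraps s (l x + real i * l \<alpha>)"] by (auto simp: wraps_bounds)
    then show ?thesis ..
  qed
  have int1: "integrable torus (\<lambda>x. wraps s (p x + r))" for r
    by (rule integrable_const_bound[where B = 1]) (auto simp: wraps_bounds)
  have int2: "integrable torus (\<lambda>x. wraps s (p x + r) * wraps s (q x + r'))" for r r'
    by (rule integrable_const_bound[where B = 1]) (auto simp: abs_mult wraps_bounds intro!: mult_le_one)
  have prod_eq: "crossings p s \<alpha> n x * (1 - crossings q s \<alpha> n x)
      = (\<Sum>i<n. wraps s (p x + real i * p \<alpha>))
        - (\<Sum>i<n. \<Sum>j<n. wraps s (p x + real i * p \<alpha>) * wraps s (q x + real j * q \<alpha>))" for x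
    by (simp add: crossings_def right_diff_distrib sum_product)
  have "1 / real K - 1 / (real K)\<^sup>2 = (\<Sum>i<n. 1 / real m) - (\<Sum>i<n. \<Sum>j<n. 1 / (real m)\<^sup>2)"
    using n K by (simp add: m_def power2_eq_square)
  also have "\<dots> = (\<integral>x. crossings p s \<alpha> n x * (1 - crossings q s \<alpha> n x) \<partial>torus)"
    unfolding prod_eq using int1 int2
    by (simp add: swap.integral_wraps_q[OF m, folded s] integral_wraps_p_q[OF m, folded s]) (simp add: s)
  also have "\<dots> \<le> (\<integral>x. indicator ?E x \<partial>torus)"
  proof (rule integral_mono)
    show "integrable torus (\<lambda>x. crossings p s \<alpha> n x * (1 - crossings q s \<alpha> n x))"
      unfolding prod_eq using int1 int2 by simp
    show "integrable torus (indicator ?E :: _ \<Rightarrow> real)"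
      by (rule integrable_const_bound[where B = 1]) (use E in auto)
    fix x :: "real^2" assume x: "x \<in> space torus"
    have "crossings p s \<alpha> n x = 0 \<or> crossings p s \<alpha> n x = 1"
      using zero_or_ge_1[of p x] once[of x] by (auto simp: s_def)
    with zero_or_ge_1[of q x] x
    show "crossings p s \<alpha> n x * (1 - crossings q s \<alpha> n x) \<le> indicator ?E x"
      by (auto split: split_indicator)
  qed
  also have "\<dots> = prob ?E" by simp
  finally show "emeasure torus ?E \<ge> ennreal (1 / real K - 1 / (real K)\<^sup>2)"
    by (simp add: emeasure_eq_measure)
qed

end

section \<open>The triangle\<close>

text \<open>
  The second alternative is the image of the edge \<open>x\<^sub>2 = 1\<close>.
\<close>
lemma mem_mod1_Delta0_iff:
  assumes x: "x \<in> space torus"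
  shows "x \<in> mod1 ` Delta0 \<longleftrightarrow> x $ 1 < x $ 2 \<or> x $ 2 = 0"
proof
  assume "x \<in> mod1 ` Delta0"
  then obtain z where z: "x = mod1 z" "z $ 1 \<in> {0..1}" "z $ 2 \<in> {0..1}" "z $ 1 < z $ 2"
    by (auto simp: Delta0_def)
  then have "x $ 1 = z $ 1" by (simp add: mod1_def frac_eq)
  moreover have "x $ 2 = (if z $ 2 = 1 then 0 else z $ 2)"
    using z by (simp add: mod1_def frac_eq)
  ultimately show "x $ 1 < x $ 2 \<or> x $ 2 = 0" using z(4) by (auto split: if_splits)
next
  have bounds: "0 \<le> x $ i" "x $ i < 1" for i using x by (auto simp: space_torus)
  assume "x $ 1 < x $ 2 \<or> x $ 2 = 0"
  then show "x \<in> mod1 ` Delta0"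
  proof
    assume "x $ 1 < x $ 2"
    then have "x \<in> Delta0" using bounds by (auto simp: Delta0_def less_imp_le)
    then show ?thesis using mod1_torus[OF x] by (metis imageI)
  next
    assume x2: "x $ 2 = 0"
    define z :: "real^2" where "z = vector [x $ 1, 1]"
    have "z \<in> Delta0" using bounds[of 1] by (auto simp: Delta0_def z_def forall_2)
    moreover have "x = mod1 z"
      using bounds[of 1] x2 by (simp add: vec_eq_iff forall_2 mod1_def z_def frac_eq)
    ultimately show ?thesis by blast
  qed
qed

text \<open>
  The term \<open>1 - frac (- x\<^sub>2)\<close> is the representative of \<open>x\<^sub>2\<close> in \<open>(0, 1]\<close>. This choice, instead of
  \<open>frac x\<^sub>2\<close>, makes the identity exact on the edge \<open>x\<^sub>2 = 0\<close> as well.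
\<close>
lemma Phi_eq_frac:
  assumes x: "x \<in> space torus"
  shows "Phi a x = (1 + frac (x $ 1 - x $ 2) - frac (x $ 1) - frac (- x $ 2)) *\<^sub>R a"
proof -
  have b: "0 \<le> x $ i" "x $ i < 1" for i using x by (auto simp: space_torus)
  have f1: "frac (x $ 1) = x $ 1" using b[of 1] by (simp add: frac_eq)
  have f2: "frac (- x $ 2) = (if x $ 2 = 0 then 0 else 1 - x $ 2)"
    using b[of 2] by (auto simp: frac_unique_iff)
  have f12: "frac (x $ 1 - x $ 2) = x $ 1 - x $ 2 + (if x $ 1 < x $ 2 then 1 else 0)"
    using b[of 1] b[of 2] by (auto simp: frac_unique_iff)
  show ?thesis
    using b[of 1] mem_mod1_Delta0_iff[OF x] unfolding Phi_def f1 f2 f12 by (auto split: split_indicator)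
qed

lemma Phi_mod1:
  "Phi a (mod1 x) = (1 + frac (x $ 1 - x $ 2) - frac (x $ 1) - frac (- x $ 2)) *\<^sub>R a"
proof -
  have "frac (frac s - frac t) = frac (s - t)" for s t :: real
    using frac_diff_simp[of "frac s" t] frac_add_simps(1)[of s "- t"] by simp
  then show ?thesis
    unfolding Phi_eq_frac[OF mod1_in_torus] by (simp add: mod1_def frac_neg_frac)
qed

lemma Phi_measurable: "Phi a \<in> borel_measurable torus"
proof -
  have "(\<lambda>x::real^2. (1 + frac (x $ 1 - x $ 2) - frac (x $ 1) - frac (- x $ 2)) *\<^sub>R a) \<in> borel_measurable torus"
    by (rule borel_imp_torus) (unfold frac_def, measurable)
  then show ?thesis
    by (subst measurable_cong[OF Phi_eq_frac])
qed

context torus_coordinates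
begin

text \<open>
  The third argument \<open>r\<close> does not feel the translation, and \<open>p\<close> and \<open>q\<close> both grow by \<open>s\<close>. They enter the
  cocycle with opposite signs, so that only the passages through integers remain.
\<close>
lemma birkhoff_sum_jump:
  assumes Phi: "\<And>x. Phi a (mod1 x) = (1 + frac (q x) - frac (p x) - frac (r x)) *\<^sub>R a"
    and r: "linear r" "r (u + u') = 0"
    and s: "0 \<le> s" "s < 1"
  shows "birkhoff_sum \<alpha> (Phi a) n (mod1 (x + s *\<^sub>R (u + u')))
    = birkhoff_sum \<alpha> (Phi a) n x + (crossings p s \<alpha> n x - crossings q s \<alpha> n x) *\<^sub>R a"
proof -
  have jump: "Phi a (mod1 (mod1 (x + s *\<^sub>R (u + u')) + real i *\<^sub>R \<alpha>))
      = Phi a (mod1 (x + real i *\<^sub>R \<alpha>)) + (wraps s (p x + real i * p \<alpha>) - wraps s (q x + real i * q \<alpha>)) *\<^sub>R a" for i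
  proof -
    have "r (s *\<^sub>R (u + u')) = 0" using linear_cmul[OF r(1), of s "u + u'"] r(2) by simp
    then have r': "r (x + s *\<^sub>R (u + u') + real i *\<^sub>R \<alpha>) = r (x + real i *\<^sub>R \<alpha>)"
      by (simp only: linear_add[OF r(1)])
    have p': "p (x + s *\<^sub>R (u + u') + real i *\<^sub>R \<alpha>) = (p x + real i * p \<alpha>) + s"
      and q': "q (x + s *\<^sub>R (u + u') + real i *\<^sub>R \<alpha>) = (q x + real i * q \<alpha>) + s"
      by (simp_all add: linear_add[OF linear_p] linear_cmul[OF linear_p] linear_add[OF linear_q] linear_cmul[OF linear_q])
    have pq: "p (x + real i *\<^sub>R \<alpha>) = p x + real i * p \<alpha>" "q (x + real i *\<^sub>R \<alpha>) = q x + real i * q \<alpha>"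
      by (simp_all add: linear_add[OF linear_p] linear_cmul[OF linear_p] linear_add[OF linear_q] linear_cmul[OF linear_q])
    show ?thesis
      unfolding mod1_add_mod1 Phi p' q' r' pq frac_add_eq_wraps[OF s] by (simp flip: scaleR_add_left)
  qed
  show ?thesis
    unfolding birkhoff_sum_def jump crossings_def
    by (simp add: sum.distrib flip: scaleR_sum_left sum_subtractf)
qed

text \<open>
  At time \<open>n + 1\<close> the translation is by \<open>(u + u') / (K (n + 1))\<close>. The essential value is \<open>a\<close> if the
  separated orbit is that of \<open>p\<close>, and \<open>- a\<close> if it is that of \<open>q\<close>.
\<close>
lemma ergodic_Phi:
  assumes \<alpha>: "totally_irrational \<alpha>" and a: "totally_irrational a"
    and bad: "badly_approximable (p \<alpha>) \<or> badly_approximable (q \<alpha>)"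
    and Phi: "\<And>x. Phi a (mod1 x) = (1 + frac (q x) - frac (p x) - frac (r x)) *\<^sub>R a"
    and r: "linear r" "r (u + u') = 0"
  shows "ergodic (torus \<Otimes>\<^sub>M torus) (compact_extension \<alpha> (Phi a))"
proof -
  interpret swap: torus_coordinates q p u' u by (rule swap)
  define s where "s K n = 1 / real (K * Suc n)" for K n :: nat
  have h: "(\<lambda>n. s K n *\<^sub>R (u + u')) \<longlonglongrightarrow> 0" for K
  proof -
    have "(\<lambda>n. (1 / real K) * (1 / real (Suc n))) \<longlonglongrightarrow> (1 / real K) * 0"
      by (intro tendsto_mult tendsto_const LIMSEQ_Suc lim_1_over_n)
    moreover have "s K n = (1 / real K) * (1 / real (Suc n))" for n
      by (simp only: s_def of_nat_mult times_divide_times_eq mult_1)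
    ultimately have "(\<lambda>n. s K n *\<^sub>R (u + u')) \<longlonglongrightarrow> 0 *\<^sub>R (u + u')"
      by (intro tendsto_scaleR tendsto_const) simp
    then show ?thesis by simp
  qed
  have s: "0 \<le> s K n" "s K n < 1" if "K \<ge> 2" for K n
  proof -
    have "2 * 1 \<le> K * Suc n" using that by (intro mult_le_mono) auto
    then have "real (K * Suc n) \<ge> 2" by linarith
    then show "0 \<le> s K n" "s K n < 1" by (simp_all add: s_def del: of_nat_mult of_nat_Suc)
  qed
  have \<delta>: "1 / real K - 1 / (real K)\<^sup>2 > 0" if "K \<ge> 2" for K
    using that by (simp add: power2_eq_square field_simps)
  note jump = birkhoff_sum_jump[OF Phi r]
  from bad show ?thesis
  proof
    assume "badly_approximable (p \<alpha>)"
    then obtain K where K: "K \<ge> 2" and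
      once: "\<And>n t. n > 0 \<Longrightarrow> (\<Sum>i<n. wraps (1 / real (K * n)) (t + real i * p \<alpha>)) \<le> 1"
      by (rule badly_approximable_wraps_once) (rule that, assumption, blast)
    define E where "E n = {x \<in> space torus. crossings p (s K n) \<alpha> (Suc n) x = 1 \<and> crossings q (s K n) \<alpha> (Suc n) x = 0}" for n
    have once': "crossings p (1 / real (K * Suc n)) \<alpha> (Suc n) x \<le> 1" for n x
      unfolding crossings_def by (rule once) simp
    show ?thesis
    proof (rule ergodic_if_totally_irrational_essential_value[OF \<alpha> a Phi_measurable h \<delta>[OF K]])
      show "E n \<in> sets torus" and "ennreal (1 / real K - 1 / (real K)\<^sup>2) \<le> emeasure torus (E n)" for n
        using prob_single_crossing[OF K _ once', of n] by (simp_all add: E_def s_def)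
      show "birkhoff_sum \<alpha> (Phi a) (Suc n) (mod1 (x + s K n *\<^sub>R (u + u'))) = birkhoff_sum \<alpha> (Phi a) (Suc n) x + a"
        if "x \<in> E n" for n x
        using that by (simp add: jump[OF s[OF K]] E_def)
    qed
  next
    assume "badly_approximable (q \<alpha>)"
    then obtain K where K: "K \<ge> 2" and
      once: "\<And>n t. n > 0 \<Longrightarrow> (\<Sum>i<n. wraps (1 / real (K * n)) (t + real i * q \<alpha>)) \<le> 1"
      by (rule badly_approximable_wraps_once) (rule that, assumption, blast)
    define E where "E n = {x \<in> space torus. crossings q (s K n) \<alpha> (Suc n) x = 1 \<and> crossings p (s K n) \<alpha> (Suc n) x = 0}" for n
    have once': "crossings q (1 / real (K * Suc n)) \<alpha> (Suc n) x \<le> 1" for n x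
      unfolding crossings_def by (rule once) simp
    show ?thesis
    proof (rule ergodic_if_totally_irrational_essential_value[OF \<alpha> totally_irrational_uminus[OF a] Phi_measurable h \<delta>[OF K]])
      show "E n \<in> sets torus" and "ennreal (1 / real K - 1 / (real K)\<^sup>2) \<le> emeasure torus (E n)" for n
        using swap.prob_single_crossing[OF K _ once', of n] by (simp_all add: E_def s_def)
      show "birkhoff_sum \<alpha> (Phi a) (Suc n) (mod1 (x + s K n *\<^sub>R (u + u'))) = birkhoff_sum \<alpha> (Phi a) (Suc n) x + - a"
        if "x \<in> E n" for n x
        using that by (simp add: jump[OF s[OF K]] E_def)
    qed
  qed
qed

end

theorem theorem4p3:
  fixes \<alpha> :: "real ^ 2" and a :: "real ^ 'd"
  assumes "totally_irrational \<alpha>"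
    and "badly_approximable (\<alpha> $ 1) \<or> badly_approximable (\<alpha> $ 2) \<or> badly_approximable (\<alpha> $ 1 - \<alpha> $ 2)"
    and "totally_irrational a"
  shows "ergodic ((torus :: (real ^ 2) measure) \<Otimes>\<^sub>M (torus :: (real ^ 'd) measure))
           (compact_extension \<alpha> (Phi a))"
proof -
  have Ints: "frac t - t \<in> \<int>" "t - frac t \<in> \<int>" "frac s - frac t - (s - t) \<in> \<int>" for s t :: real
    by (simp_all add: frac_def)
  have linear: "linear (\<lambda>x::real^2. x $ i)" "linear (\<lambda>x::real^2. - x $ i)"
    "linear (\<lambda>x::real^2. x $ 1 - x $ 2)" for i
    by (simp_all add: linear_iff algebra_simps)
  \<comment> \<open>The sum of the two dual vectors is the direction of translation: \<open>(1, 0)\<close> for \<open>horizontal\<close>, which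
    fixes \<open>x\<^sub>2\<close>, and \<open>(0, - 1)\<close> for \<open>vertical\<close>, which fixes \<open>x\<^sub>1\<close>.\<close>
  interpret horizontal: torus_coordinates "\<lambda>x. x $ 1" "\<lambda>x. x $ 1 - x $ 2" "vector [1, 1]" "vector [0, -1]"
    by (simp add: torus_coordinates_def linear mod1_def Ints)
  interpret vertical: torus_coordinates "\<lambda>x. - x $ 2" "\<lambda>x. x $ 1 - x $ 2" "vector [-1, -1]" "vector [1, 0]"
    by (simp add: torus_coordinates_def linear mod1_def Ints)
  consider "badly_approximable (\<alpha> $ 1) \<or> badly_approximable (\<alpha> $ 1 - \<alpha> $ 2)"
    | "badly_approximable (- \<alpha> $ 2)"
    using assms(2) badly_approximable_uminus by blast
  then show ?thesis
  proof cases
    case 1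
    show ?thesis
      by (rule horizontal.ergodic_Phi[OF assms(1,3) 1, where r = "\<lambda>x. - x $ 2"])
        (simp_all add: Phi_mod1 linear)
  next
    case 2
    show ?thesis
      by (rule vertical.ergodic_Phi[OF assms(1,3), where r = "\<lambda>x. x $ 1"])
        (simp_all add: 2 Phi_mod1 linear algebra_simps)
  qed
qed

end
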